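(* Let $c,n>1$, and suppose there is a pseudo-deterministic algorithm $Q$ that, given an instance of $\mathsf{ShiftFinding}_{c,n}$, makes at most $q=q(c,n)$ (possibly adaptive) queries to $F_{s^*}$, and whose canonical function $M$ maps each instance to a set $R\subset[0,n]$ of size $t=t_c(n)$ that contains $s^*$. Then every pseudo-deterministic streaming algorithm for $\mathsf{ApproxCount}_{c,n}$ must use $\Omega\big(\frac{\log(n/t)}{\log q}\big)$ bits of space.
   Context: An instance of Shift Finding $\mathsf{ShiftFinding}_{c,n}$ consists of a string $P\in\{0,1\}^{(c-1)n}$ (fully known to the algorithm) together with query access to a string $F_{s^*}$ which is the concatenation of $n-s^*$ zeros, then $P$, then $s^*$ ones, for an unknown $s^*\in[0,n]$; a query at $x\in[0,cn]$ returns $F_{s^*}(x)$. A randomized algorithm $Q$ on such instances is pseudo-deterministic with canonical function $M$ if for every instance $I$, $\Pr[Q(I)=M(I)]\ge 9/10$ over $Q$'s randomness. $\mathsf{ApproxCount}_{c,n}$: the input is a stream of length at most $(c+1)n$, and the algorithm must distinguish whether the number of stream items is at most $n$ or greater than $cn$ (correct with probability at least $9/10$ on streams satisfying this promise). A streaming algorithm $A$ is pseudo-deterministic if there is a function $F$ defined on all input streams (including those outside the promise), its canonical function, such that for every stream $\sigma$, $\Pr[A(\sigma)=F(\sigma)]\ge 9/10$ over the algorithm's randomness. Space is measured in bits. *)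

theory Defs
  imports "HOL-Probability.Probability"
begin

text \<open>Adaptive query algorithms. For a fixed outcome of its coins an algorithm is a decision tree;
  a randomized algorithm is a distribution over such trees.\<close>

datatype 'r query_tree =
    Answer 'r
  | Query nat "'r query_tree" "'r query_tree"  \<comment> \<open>position; continuation on reply 0; on reply 1\<close>

primrec tree_result :: "(nat \<Rightarrow> bool) \<Rightarrow> 'r query_tree \<Rightarrow> 'r" where
  "tree_result f (Answer r) = r"
| "tree_result f (Query x T0 T1) = (if f x then tree_result f T1 else tree_result f T0)"

primrec queries_made :: "(nat \<Rightarrow> bool) \<Rightarrow> 'r query_tree \<Rightarrow> nat list" where
  "queries_made f (Answer r) = []"
| "queries_made f (Query x T0 T1) =
     x # (if f x then queries_made f T1 else queries_made f T0)"

text \<open>The symbols 0 and 1 are \<^const>\<open>False\<close> and \<^const>\<open>True\<close>. An instance is a pair of a string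
  \<open>P\<close> and a shift \<open>s\<close>. The parameter \<open>c\<close> is real; if \<open>(c - 1) n\<close> is not an integer, the
  length of \<open>P\<close> is rounded down, which agrees with reading the thresholds \<open>\<le> c n\<close> and \<open>> c n\<close>
  over the natural numbers.\<close>

definition sf_instance :: "real \<Rightarrow> nat \<Rightarrow> bool list \<Rightarrow> nat \<Rightarrow> bool" where
  "sf_instance c n P s \<longleftrightarrow> length P = nat \<lfloor>(c - 1) * real n\<rfloor> \<and> s \<le> n"

definition shifted_string :: "nat \<Rightarrow> bool list \<Rightarrow> nat \<Rightarrow> bool list" where
  "shifted_string n P s = replicate (n - s) False @ P @ replicate s True"

text \<open>The string has \<open>c n\<close> symbols while queries range over the \<open>c n + 1\<close> positions \<open>0, \<dots>, c n\<close>: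
  the symbols occupy positions \<open>1, \<dots>, c n\<close>, and position 0 always holds a 0.\<close>

definition sf_oracle :: "nat \<Rightarrow> bool list \<Rightarrow> nat \<Rightarrow> nat \<Rightarrow> bool" where
  "sf_oracle n P s x = (if x = 0 then False else shifted_string n P s ! (x - 1))"

type_synonym sf_algorithm = "bool list \<Rightarrow> nat set query_tree pmf"

definition sf_makes_queries :: "real \<Rightarrow> nat \<Rightarrow> nat \<Rightarrow> sf_algorithm \<Rightarrow> bool" where
  "sf_makes_queries c n q Q \<longleftrightarrow>
     (\<forall>P s. sf_instance c n P s \<longrightarrow>
        (\<forall>T \<in> set_pmf (Q P).
           length (queries_made (sf_oracle n P s) T) \<le> q \<and>
           (\<forall>x \<in> set (queries_made (sf_oracle n P s) T). real x \<le> c * real n)))"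

definition sf_output :: "nat \<Rightarrow> sf_algorithm \<Rightarrow> bool list \<Rightarrow> nat \<Rightarrow> nat set pmf" where
  "sf_output n Q P s = map_pmf (tree_result (sf_oracle n P s)) (Q P)"

definition sf_canonical ::
  "real \<Rightarrow> nat \<Rightarrow> sf_algorithm \<Rightarrow> (bool list \<Rightarrow> nat \<Rightarrow> nat set) \<Rightarrow> bool" where
  "sf_canonical c n Q M \<longleftrightarrow>
     (\<forall>P s. sf_instance c n P s \<longrightarrow> pmf (sf_output n Q P s) (M P s) \<ge> 9 / 10)"

definition sf_finds_shift ::
  "real \<Rightarrow> nat \<Rightarrow> nat \<Rightarrow> (bool list \<Rightarrow> nat \<Rightarrow> nat set) \<Rightarrow> bool" where
  "sf_finds_shift c n t M \<longleftrightarrow>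
     (\<forall>P s. sf_instance c n P s \<longrightarrow> M P s \<subseteq> {0..n} \<and> card (M P s) = t \<and> s \<in> M P s)"

text \<open>Randomized streaming algorithms over items of type \<open>'a\<close>. The memory is a bit string and is
  all that is carried from one item to the next; fresh coins are available at every step.\<close>

record 'a stream_alg =
  init :: "bool list pmf"
  step :: "bool list \<Rightarrow> 'a \<Rightarrow> bool list pmf"
  out :: "bool list \<Rightarrow> bool pmf"

definition memory_after :: "'a stream_alg \<Rightarrow> 'a list \<Rightarrow> bool list pmf" where
  "memory_after A \<sigma> = foldl (\<lambda>D a. bind_pmf D (\<lambda>w. step A w a)) (init A) \<sigma>"

definition stream_output :: "'a stream_alg \<Rightarrow> 'a list \<Rightarrow> bool pmf" where
  "stream_output A \<sigma> = bind_pmf (memory_after A \<sigma>) (out A)"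

definition input_stream :: "real \<Rightarrow> nat \<Rightarrow> 'a list \<Rightarrow> bool" where
  "input_stream c n \<sigma> \<longleftrightarrow> real (length \<sigma>) \<le> (c + 1) * real n"

definition solves_approx_count :: "real \<Rightarrow> nat \<Rightarrow> 'a stream_alg \<Rightarrow> bool" where
  "solves_approx_count c n A \<longleftrightarrow>
     (\<forall>\<sigma>. input_stream c n \<sigma> \<longrightarrow>
        (length \<sigma> \<le> n \<longrightarrow> pmf (stream_output A \<sigma>) False \<ge> 9 / 10) \<and>
        (real (length \<sigma>) > c * real n \<longrightarrow> pmf (stream_output A \<sigma>) True \<ge> 9 / 10))"

definition stream_pseudo_deterministic :: "real \<Rightarrow> nat \<Rightarrow> 'a stream_alg \<Rightarrow> bool" where
  "stream_pseudo_deterministic c n A \<longleftrightarrow>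
     (\<exists>F :: 'a list \<Rightarrow> bool. \<forall>\<sigma>. input_stream c n \<sigma> \<longrightarrow> pmf (stream_output A \<sigma>) (F \<sigma>) \<ge> 9 / 10)"

definition uses_space :: "real \<Rightarrow> nat \<Rightarrow> 'a stream_alg \<Rightarrow> nat \<Rightarrow> bool" where
  "uses_space c n A S \<longleftrightarrow>
     (\<forall>\<sigma>. input_stream c n \<sigma> \<longrightarrow> (\<forall>w \<in> set_pmf (memory_after A \<sigma>). length w \<le> S))"

end

theory Submission
  imports Defs
begin

text \<open>
  Feed the streaming algorithm \<open>s\<close> copies of one item. Taking for \<open>P\<close> the canonical answers on
  \<open>n + 1, \<dots>, c n\<close> items, the answer after \<open>x\<close> further items is the symbol at position \<open>x\<close> of the
  string shifted by \<open>s\<close>, so a random memory state reached after \<open>s\<close> items answers each single query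
  correctly with constant probability. A potential-function argument yields \<open>k = O(log q)\<close> memory
  states whose majority vote is correct on all positions the query algorithm reads, except with
  small probability over its coins. These states therefore determine the canonical set for \<open>s\<close>.
  As sets of size \<open>t\<close> that cover \<open>{0..n}\<close> number at least \<open>n / t\<close>, counting tuples of memory states
  gives \<open>n / t \<le> 2 ^ ((S + 1) k)\<close>.
\<close>

section \<open>Facts on decision trees and discrete distributions\<close>

text \<open>Agreement is asked only along the path taken under \<open>f\<close>: equal replies there
  force \<open>h\<close> down the same path, so adaptivity causes no difficulty.\<close>

lemma tree_result_cong:
  assumes "\<And>x. x \<in> set (queries_made f T) \<Longrightarrow> h x = f x"
  shows "tree_result h T = tree_result f T"
  using assms by (induction T) auto

lemma pmf_eq_if_gt_half:
  assumes "pmf D x > 1 / 2" and "pmf D y > 1 / 2"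
  shows "x = y"
proof (rule ccontr)
  assume "x \<noteq> y"
  then have "measure_pmf.prob D {x, y} = pmf D x + pmf D y"
    by (subst measure_measure_pmf_finite) auto
  then show False
    using assms measure_pmf.prob_le_1[of D "{x, y}"] by linarith
qed

lemma pmf_ex_le_expectation:
  fixes g :: "'b \<Rightarrow> real"
  assumes "finite (set_pmf D)"
  shows "\<exists>w \<in> set_pmf D. g w \<le> measure_pmf.expectation D g"
proof (rule ccontr)
  assume "\<not> ?thesis"
  then have "AE w in measure_pmf D. measure_pmf.expectation D g < g w"
    by (auto simp: AE_measure_pmf_iff)
  then have "measure_pmf.expectation D g < measure_pmf.expectation D g"
    by (intro measure_pmf.expectation_greater integrable_measure_pmf_finite assms)
  then show False by simp
qed

subsection \<open>Majority votes\<close>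

text \<open>A product of these weights is at least 1 iff at least half of the votes are wrong. At
  error probability 1/5 the mean weight is 1/2 + 3/2 * 1/5 = 4/5.\<close>

definition vote_weight :: "('w \<Rightarrow> 'x \<Rightarrow> bool) \<Rightarrow> 'w \<Rightarrow> 'x \<Rightarrow> real" where
  "vote_weight bad w x = (if bad w x then 2 else 1 / 2)"

lemma vote_weight_pos: "vote_weight bad w x > 0"
  by (simp add: vote_weight_def)

lemma expectation_vote_weight:
  assumes "measure_pmf.prob D {w. bad w x} \<le> 1 / 5"
  shows "measure_pmf.expectation D (\<lambda>w. vote_weight bad w x) \<le> 4 / 5"
proof -
  have "(\<lambda>w. vote_weight bad w x) = (\<lambda>w. 1 / 2 + 3 / 2 * indicator {w. bad w x} w)"
    by (auto simp: vote_weight_def indicator_def)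
  then have "measure_pmf.expectation D (\<lambda>w. vote_weight bad w x)
      = 1 / 2 + 3 / 2 * measure_pmf.prob D {w. bad w x}"
    by (simp add: measure_pmf.prob_space measure_pmf.integrable_const_bound[where B = 1])
  then show ?thesis using assms by simp
qed

text \<open>The voters are chosen one at a time, each decreasing the potential by a factor \<open>4 / 5\<close>; this
  replaces independent sampling and a Chernoff bound.\<close>

lemma ex_voters_small_potential:
  fixes \<mu> :: "'x \<Rightarrow> real"
  assumes "finite (set_pmf D)" and "finite X"
    and "\<And>x. x \<in> X \<Longrightarrow> measure_pmf.prob D {w. bad w x} \<le> 1 / 5"
    and "\<And>x. x \<in> X \<Longrightarrow> \<mu> x \<ge> 0"
  shows "\<exists>ws. length ws = k \<and> set ws \<subseteq> set_pmf D \<and>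
    (\<Sum>x\<in>X. \<mu> x * (\<Prod>w\<leftarrow>ws. vote_weight bad w x)) \<le> (4 / 5) ^ k * (\<Sum>x\<in>X. \<mu> x)"
  using assms(4)
proof (induction k arbitrary: \<mu>)
  case 0
  then show ?case by simp
next
  case (Suc k)
  \<comment> \<open>Averaging the whole sum gives a single \<open>w\<close> that serves all
    positions together, though not each one separately.\<close>
  obtain w where w: "w \<in> set_pmf D"
    and le: "(\<Sum>x\<in>X. \<mu> x * vote_weight bad w x)
      \<le> measure_pmf.expectation D (\<lambda>w. \<Sum>x\<in>X. \<mu> x * vote_weight bad w x)"
    using pmf_ex_le_expectation[OF assms(1), of "\<lambda>w. \<Sum>x\<in>X. \<mu> x * vote_weight bad w x"] by auto
  have "measure_pmf.expectation D (\<lambda>w. \<Sum>x\<in>X. \<mu> x * vote_weight bad w x)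
      = (\<Sum>x\<in>X. \<mu> x * measure_pmf.expectation D (\<lambda>w. vote_weight bad w x))"
    by (subst Bochner_Integration.integral_sum)
      (auto intro: integrable_measure_pmf_finite assms(1))
  also have "\<dots> \<le> (\<Sum>x\<in>X. \<mu> x * (4 / 5))"
    by (intro sum_mono mult_left_mono expectation_vote_weight assms(3) Suc.prems)
  also have "\<dots> = 4 / 5 * (\<Sum>x\<in>X. \<mu> x)"
    unfolding sum_distrib_right[symmetric] by (rule mult.commute)
  finally have step: "(\<Sum>x\<in>X. \<mu> x * vote_weight bad w x) \<le> 4 / 5 * (\<Sum>x\<in>X. \<mu> x)"
    using le by linarith
  \<comment> \<open>The weight of \<open>w\<close> is absorbed into \<open>\<mu>\<close>; for this
    the induction generalises over \<open>\<mu>\<close>.\<close>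
  obtain ws where ws: "length ws = k" "set ws \<subseteq> set_pmf D"
    "(\<Sum>x\<in>X. \<mu> x * vote_weight bad w x * (\<Prod>w\<leftarrow>ws. vote_weight bad w x))
      \<le> (4 / 5) ^ k * (\<Sum>x\<in>X. \<mu> x * vote_weight bad w x)"
    using Suc.IH[of "\<lambda>x. \<mu> x * vote_weight bad w x"] Suc.prems
    by (auto simp: less_imp_le[OF vote_weight_pos])
  have "(4 / 5) ^ k * (\<Sum>x\<in>X. \<mu> x * vote_weight bad w x) \<le> (4 / 5) ^ k * (4 / 5 * (\<Sum>x\<in>X. \<mu> x))"
    using step by (intro mult_left_mono) auto
  also have "\<dots> = (4 / 5) ^ Suc k * (\<Sum>x\<in>X. \<mu> x)"
    by simp
  finally have "(\<Sum>x\<in>X. \<mu> x * (\<Prod>v\<leftarrow>w # ws. vote_weight bad v x))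
      \<le> (4 / 5) ^ Suc k * (\<Sum>x\<in>X. \<mu> x)"
    using ws(3) unfolding list.map prod_list.Cons mult.assoc by linarith
  then show ?case
    using ws w by (intro exI[of _ "w # ws"]) auto
qed

lemma prod_list_vote_weight:
  "(\<Prod>w\<leftarrow>ws. vote_weight bad w x) * 2 ^ length ws = 4 ^ length (filter (\<lambda>w. bad w x) ws)"
  by (induction ws) (auto simp: vote_weight_def)

definition majority :: "('w \<Rightarrow> 'x \<Rightarrow> bool) \<Rightarrow> 'w list \<Rightarrow> 'x \<Rightarrow> bool" where
  "majority b ws x \<longleftrightarrow> length ws < 2 * length (filter (\<lambda>w. b w x) ws)"

text \<open>A wrong majority, ties included, means that at least half of the voters err at
  \<open>x\<close>, so the factors 2 are no fewer than the factors 1/2.\<close>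

lemma prod_list_vote_weight_ge_1:
  assumes "majority b ws x \<noteq> f x"
  shows "(\<Prod>w\<leftarrow>ws. vote_weight (\<lambda>w x. b w x \<noteq> f x) w x) \<ge> 1"
proof -
  let ?l = "length (filter (\<lambda>w. b w x \<noteq> f x) ws)"
  have "length ws \<le> 2 * ?l"
    using assms sum_length_filter_compl[of "\<lambda>w. b w x" ws]
    by (cases "f x") (auto simp: majority_def)
  then have "(2::real) ^ length ws \<le> 2 ^ (2 * ?l)"
    by (intro power_increasing) auto
  also have "\<dots> = 4 ^ ?l"
    by (simp add: power_mult)
  also have "\<dots> = (\<Prod>w\<leftarrow>ws. vote_weight (\<lambda>w x. b w x \<noteq> f x) w x) * 2 ^ length ws"
    by (rule prod_list_vote_weight[symmetric])
  finally show ?thesis by simp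
qed

text \<open>Each position is weighted by the probability that it is read under the true oracle
  \<open>f\<close>. The total weight is at most \<open>q\<close>, so the potential bound leaves
  weight below 2/5 on positions with a wrong majority. Off those the trees cannot tell the two
  oracles apart.\<close>

lemma ex_voters_majority_correct:
  fixes D :: "'w pmf" and QT :: "'r query_tree pmf"
  assumes "finite (set_pmf D)" and "finite X"
    and weak: "\<And>x. x \<in> X \<Longrightarrow> measure_pmf.prob D {w. b w x \<noteq> f x} \<le> 1 / 5"
    and queries: "\<And>T. T \<in> set_pmf QT \<Longrightarrow>
      length (queries_made f T) \<le> q \<and> set (queries_made f T) \<subseteq> X"
    and good: "pmf (map_pmf (tree_result f) QT) R \<ge> 9 / 10"
    and k: "(4 / 5) ^ k * real q < 2 / 5"
  shows "\<exists>ws. length ws = k \<and> set ws \<subseteq> set_pmf D \<and>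
    pmf (map_pmf (tree_result (majority b ws)) QT) R > 1 / 2"
proof -
  define E :: "nat \<Rightarrow> 'r query_tree set" where "E x = {T. x \<in> set (queries_made f T)}" for x
  define \<mu> where "\<mu> x = measure_pmf.prob QT (E x)" for x
  have int: "integrable (measure_pmf QT) (indicator (E x) :: _ \<Rightarrow> real)" for x
    by (rule measure_pmf.integrable_const_bound[where B = 1]) (auto simp: indicator_def)
  \<comment> \<open>This is the expected number of distinct positions read.\<close>
  have "(\<Sum>x\<in>X. \<mu> x) = measure_pmf.expectation QT (\<lambda>T. \<Sum>x\<in>X. indicator (E x) T)"
    by (subst Bochner_Integration.integral_sum) (auto simp: \<mu>_def int)
  also have "\<dots> \<le> measure_pmf.expectation QT (\<lambda>T. real q)"
  proof (rule integral_mono_AE)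
    show "AE T in measure_pmf QT. (\<Sum>x\<in>X. indicator (E x) T) \<le> real q"
    proof (subst AE_measure_pmf_iff, rule ballI)
      fix T assume T: "T \<in> set_pmf QT"
      have "(\<Sum>x\<in>X. indicator (E x) T :: real) = (\<Sum>x\<in>X. if x \<in> set (queries_made f T) then 1 else 0)"
        by (intro sum.cong) (auto simp: E_def)
      also have "\<dots> = card (X \<inter> set (queries_made f T))"
        using assms(2) by (simp add: sum.If_cases)
      also have "card (X \<inter> set (queries_made f T)) \<le> card (set (queries_made f T))"
        by (intro card_mono) auto
      also have "\<dots> \<le> length (queries_made f T)"
        by (rule card_length)
      also have "\<dots> \<le> q" using queries[OF T] by simp
      finally show "(\<Sum>x\<in>X. indicator (E x) T) \<le> real q" by simp
    qed
  qed (auto intro: int)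
  finally have sum_\<mu>: "(\<Sum>x\<in>X. \<mu> x) \<le> q" by (simp add: measure_pmf.prob_space)
  let ?bad = "\<lambda>w x. b w x \<noteq> f x"
  obtain ws where ws: "length ws = k" "set ws \<subseteq> set_pmf D"
    and pot: "(\<Sum>x\<in>X. \<mu> x * (\<Prod>w\<leftarrow>ws. vote_weight ?bad w x)) \<le> (4 / 5) ^ k * (\<Sum>x\<in>X. \<mu> x)"
    using ex_voters_small_potential[of D X ?bad \<mu> k] assms(1,2) weak
    by (auto simp: \<mu>_def)
  define W where "W = {x \<in> X. majority b ws x \<noteq> f x}"
  have nonneg: "(\<Prod>w\<leftarrow>ws. vote_weight ?bad w x) \<ge> 0" for x
    by (intro prod_list_nonneg) (auto simp: less_imp_le[OF vote_weight_pos])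
  have "(\<Sum>x\<in>W. \<mu> x) \<le> (\<Sum>x\<in>W. \<mu> x * (\<Prod>w\<leftarrow>ws. vote_weight ?bad w x))"
  proof (rule sum_mono)
    fix x assume "x \<in> W"
    then have "(\<Prod>w\<leftarrow>ws. vote_weight ?bad w x) \<ge> 1"
      by (intro prod_list_vote_weight_ge_1) (auto simp: W_def)
    then show "\<mu> x \<le> \<mu> x * (\<Prod>w\<leftarrow>ws. vote_weight ?bad w x)"
      using mult_left_mono[of 1 _ "\<mu> x"] by (simp add: \<mu>_def)
  qed
  also have "\<dots> \<le> (\<Sum>x\<in>X. \<mu> x * (\<Prod>w\<leftarrow>ws. vote_weight ?bad w x))"
    by (intro sum_mono2 assms(2) mult_nonneg_nonneg nonneg) (auto simp: W_def \<mu>_def)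
  also note pot
  also have "(4 / 5) ^ k * (\<Sum>x\<in>X. \<mu> x) \<le> (4 / 5) ^ k * real q"
    by (intro mult_left_mono sum_\<mu>) simp
  finally have W: "(\<Sum>x\<in>W. \<mu> x) < 2 / 5" using k by simp
  have finW: "finite W" using assms(2) by (simp add: W_def)
  let ?G = "{T. tree_result f T = R}" and ?H = "{T. tree_result (majority b ws) T = R}"
  have vimg: "pmf (map_pmf (tree_result g) QT) R = measure_pmf.prob QT {T. tree_result g T = R}" for g
    by (simp add: pmf_map vimage_def)
  \<comment> \<open>Union bound: the answer \<open>R\<close> can be lost only if the path under
    \<open>f\<close> meets \<open>W\<close>. What remains exceeds 9/10 - 2/5 = 1/2.\<close>
  have "measure_pmf.prob QT ?G \<le> measure_pmf.prob QT (?H \<union> (\<Union>x\<in>W. E x))"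
  proof (rule measure_pmf.finite_measure_mono_AE)
    show "AE T in measure_pmf QT. T \<in> ?G \<longrightarrow> T \<in> ?H \<union> (\<Union>x\<in>W. E x)"
    proof (subst AE_measure_pmf_iff, intro ballI impI)
      fix T assume T: "T \<in> set_pmf QT" "T \<in> ?G"
      show "T \<in> ?H \<union> (\<Union>x\<in>W. E x)"
      proof (rule ccontr)
        assume neg: "T \<notin> ?H \<union> (\<Union>x\<in>W. E x)"
        then have "tree_result (majority b ws) T = tree_result f T"
          using queries[OF T(1)] by (intro tree_result_cong) (auto simp: W_def E_def)
        then show False using neg T(2) by auto
      qed
    qed
  qed auto
  also have "\<dots> \<le> measure_pmf.prob QT ?H + measure_pmf.prob QT (\<Union>x\<in>W. E x)"
    by (intro measure_Un_le) auto
  also have "measure_pmf.prob QT (\<Union>x\<in>W. E x) \<le> (\<Sum>x\<in>W. \<mu> x)"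
    unfolding \<mu>_def by (intro measure_UNION_le finW) auto
  finally show ?thesis
    using W good ws by (intro exI[of _ ws]) (auto simp: vimg)
qed

subsection \<open>Memory states as weak oracles\<close>

definition output_from :: "'a stream_alg \<Rightarrow> bool list \<Rightarrow> 'a list \<Rightarrow> bool pmf" where
  "output_from A w \<sigma> = bind_pmf (foldl (\<lambda>D a. bind_pmf D (\<lambda>w. step A w a)) (return_pmf w) \<sigma>) (out A)"

lemma foldl_bind_pmf:
  "foldl (\<lambda>D a. bind_pmf D (\<lambda>w. g w a)) D \<sigma>
    = bind_pmf D (\<lambda>w. foldl (\<lambda>D a. bind_pmf D (\<lambda>w. g w a)) (return_pmf w) \<sigma>)"
proof (induction \<sigma> rule: rev_induct)
  case Nil
  show ?case by (simp add: bind_return_pmf')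
next
  case (snoc a \<sigma>)
  then show ?case by (simp add: bind_assoc_pmf)
qed

lemma stream_output_append:
  "stream_output A (\<sigma> @ \<tau>) = bind_pmf (memory_after A \<sigma>) (\<lambda>w. output_from A w \<tau>)"
  unfolding stream_output_def output_from_def memory_after_def foldl_append
  by (subst foldl_bind_pmf) (simp add: bind_assoc_pmf)

text \<open>A state whose rounded answer is wrong outputs \<open>v\<close> with probability at most
  1/2. Such states thus contribute at least half their mass to the total error, which is at most
  1/10.\<close>

lemma prob_rounded_wrong_le:
  fixes G :: "'w \<Rightarrow> bool pmf"
  assumes "pmf (bind_pmf D G) v \<ge> 9 / 10"
  shows "measure_pmf.prob D {w. (pmf (G w) True > 1 / 2) \<noteq> v} \<le> 1 / 5"
proof -
  let ?B = "{w. (pmf (G w) True > 1 / 2) \<noteq> v}"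
  have FT: "pmf (G w) False = 1 - pmf (G w) True" for w
    by (rule pmf_False_conv_True)
  have "9 / 10 \<le> measure_pmf.expectation D (\<lambda>w. pmf (G w) v)"
    using assms by (simp add: pmf_bind)
  also have "\<dots> \<le> measure_pmf.expectation D (\<lambda>w. 1 - 1 / 2 * indicator ?B w)"
  proof (rule integral_mono)
    show "integrable (measure_pmf D) (\<lambda>w. pmf (G w) v)"
      by (rule measure_pmf.integrable_const_bound[where B = 1]) (auto simp: pmf_le_1)
    show "integrable (measure_pmf D) (\<lambda>w. 1 - 1 / 2 * indicator ?B w :: real)"
      by (rule measure_pmf.integrable_const_bound[where B = 1]) (auto simp: indicator_def)
    show "pmf (G w) v \<le> 1 - 1 / 2 * indicator ?B w" for w
      using pmf_le_1[of "G w" v] FT[of w] by (cases v) (auto simp: indicator_def)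
  qed
  also have "\<dots> = 1 - 1 / 2 * measure_pmf.prob D ?B"
    by (subst Bochner_Integration.integral_diff)
      (auto simp: measure_pmf.prob_space measure_pmf.integrable_const_bound[where B = 1])
  finally show ?thesis by simp
qed

text \<open>The symbol depends on \<open>s\<close> and \<open>x\<close> only through
  \<open>s + x\<close>, just as a stream of identical items depends only on its length.\<close>

lemma nth_shifted_string:
  assumes "s \<le> n" and "x < n + length P"
  shows "shifted_string n P s ! x \<longleftrightarrow>
    n \<le> s + x \<and> (s + x < n + length P \<longrightarrow> P ! (s + x - n))"
  using assms
  by (auto simp: shifted_string_def nth_append not_less less_diff_conv algebra_simps)

text \<open>With no memory bits the only state is \<open>[]\<close>, so the empty stream and one
  with more than \<open>c n\<close> items get the same output distribution.\<close>

lemma space_pos: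
  assumes "c > 1" and "n > 1"
    and "solves_approx_count c n (A :: 'a stream_alg)" and "uses_space c n A S"
  shows "S \<ge> 1"
proof (rule ccontr)
  assume "\<not> S \<ge> 1"
  then have S: "S = 0" by simp
  have mem: "memory_after A \<sigma> = return_pmf []" if "input_stream c n \<sigma>" for \<sigma>
  proof -
    have "set_pmf (memory_after A \<sigma>) \<subseteq> {[]}"
      using assms(4) that S by (auto simp: uses_space_def)
    then show ?thesis by (simp add: set_pmf_subset_singleton)
  qed
  define \<sigma> :: "'a list" where "\<sigma> = replicate (nat \<lfloor>c * real n\<rfloor> + 1) undefined"
  have len: "real (length \<sigma>) = of_int \<lfloor>c * real n\<rfloor> + 1"
    using assms(1,2) by (simp add: \<sigma>_def)
  have "real (length \<sigma>) \<le> c * real n + 1"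
    using len by linarith
  also have "\<dots> \<le> (c + 1) * real n"
    using assms(2) by (simp add: algebra_simps)
  finally have in\<sigma>: "input_stream c n \<sigma>" by (simp add: input_stream_def)
  have inNil: "input_stream c n ([] :: 'a list)"
    using assms(1) by (simp add: input_stream_def)
  have "real (length \<sigma>) > c * real n" using len by linarith
  then have "pmf (stream_output A \<sigma>) True \<ge> 9 / 10"
    using assms(3) in\<sigma> by (auto simp: solves_approx_count_def)
  moreover have "pmf (stream_output A []) False \<ge> 9 / 10"
    using assms(3) inNil by (force simp: solves_approx_count_def)
  moreover have "stream_output A \<sigma> = stream_output A []"
    using mem[OF in\<sigma>] mem[OF inNil] by (simp add: stream_output_def)
  ultimately show False
    using pmf_eq_if_gt_half[of "stream_output A []" True False] by simp
qed

text \<open>Outside the range \<open>n + 1, \<dots>, n + L\<close> of lengths the promise fixes the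
  answer, matching the zeros and ones around \<open>P\<close>; inside it \<open>P\<close> records
  the canonical answers. The length \<open>s + x\<close> never exceeds
  \<open>(c + 1) n\<close>.\<close>

lemma ex_string_encoding:
  assumes "c > 1" and "n > 1"
    and "solves_approx_count c n (A :: 'a stream_alg)" and "stream_pseudo_deterministic c n A"
  shows "\<exists>P. length P = nat \<lfloor>(c - 1) * real n\<rfloor> \<and>
    (\<forall>s x. s \<le> n \<longrightarrow> real x \<le> c * real n \<longrightarrow>
      pmf (stream_output A (replicate (s + x) undefined)) (sf_oracle n P s x) \<ge> 9 / 10)"
proof -
  obtain F where F: "\<And>\<sigma>. input_stream c n \<sigma> \<Longrightarrow> pmf (stream_output A \<sigma>) (F \<sigma>) \<ge> 9 / 10"
    using assms(4) by (auto simp: stream_pseudo_deterministic_def)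
  define u :: "nat \<Rightarrow> 'a list" where "u i = replicate i undefined" for i
  define L where "L = nat \<lfloor>(c - 1) * real n\<rfloor>"
  \<comment> \<open>Entry 0 belongs to \<open>n + 1\<close> items, the first length outside the
    promise.\<close>
  define P where "P = map (\<lambda>i. F (u (Suc n + i))) [0..<L]"
  have L: "real L = of_int \<lfloor>(c - 1) * real n\<rfloor>"
    using assms(1,2) by (simp add: L_def)
  have floor: "real x \<le> c * real n \<longleftrightarrow> x \<le> n + L" for x
  proof -
    have "real x \<le> c * real n \<longleftrightarrow> of_int (int x - int n) \<le> (c - 1) * real n"
      by (simp add: algebra_simps)
    also have "\<dots> \<longleftrightarrow> int x - int n \<le> \<lfloor>(c - 1) * real n\<rfloor>"
      by (rule le_floor_iff[symmetric])
    also have "\<dots> \<longleftrightarrow> x \<le> n + L" using L by linarith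
    finally show ?thesis .
  qed
  have "pmf (stream_output A (u (s + x))) (sf_oracle n P s x) \<ge> 9 / 10"
    if s: "s \<le> n" and x: "real x \<le> c * real n" for s x
  proof -
    have "real (s + x) \<le> real n + c * real n"
      using s x by simp
    then have inp: "input_stream c n (u (s + x))"
      by (simp add: input_stream_def u_def algebra_simps)
    have small: "pmf (stream_output A (u (s + x))) False \<ge> 9 / 10" if "s + x \<le> n"
      using assms(3) inp that by (auto simp: solves_approx_count_def u_def)
    have large: "pmf (stream_output A (u (s + x))) True \<ge> 9 / 10" if "\<not> s + x \<le> n + L"
    proof -
      have "real (length (u (s + x))) > c * real n"
        using that floor[of "s + x"] by (simp add: u_def)
      then show ?thesis
        using assms(3) inp by (auto simp: solves_approx_count_def)
    qed
    show ?thesis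
    proof (cases x)
      case 0
      then show ?thesis using small s by (simp add: sf_oracle_def)
    next
      case (Suc y)
      then have y: "y < n + length P"
        using x floor[of x] by (simp add: P_def)
      have orc: "sf_oracle n P s x \<longleftrightarrow> n \<le> s + y \<and> (s + y < n + L \<longrightarrow> P ! (s + y - n))"
        using Suc nth_shifted_string[OF s y] by (simp add: sf_oracle_def P_def)
      \<comment> \<open>As \<open>x = Suc y\<close>, these say: at most \<open>n\<close> items, a
        length in the gap, more than \<open>c n\<close> items.\<close>
      consider "s + y < n" | "n \<le> s + y" "s + y < n + L" | "n + L \<le> s + y" by linarith
      then show ?thesis
      proof cases
        case 1
        then show ?thesis using small orc Suc by simp
      next
        case 2
        then have "s + y - n < L" "Suc n + (s + y - n) = s + x"
          using Suc by linarith+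
        then have "P ! (s + y - n) = F (u (s + x))"
          by (simp add: P_def)
        then show ?thesis using F[OF inp] orc 2 by simp
      next
        case 3
        then show ?thesis using large orc Suc by simp
      qed
    qed
  qed
  then show ?thesis
    by (intro exI[of _ P]) (simp add: P_def L_def u_def)
qed

subsection \<open>Counting tuples of memory states\<close>

lemma card_bool_lists_le: "card {w :: bool list. length w \<le> S} \<le> 2 ^ Suc S"
proof -
  have "card {w :: bool list. length w \<le> S} = (\<Sum>i\<le>S. 2 ^ i)"
    using card_lists_length_le[of "UNIV :: bool set" S] by simp
  also have "\<dots> = 2 ^ Suc S - 1"
    using sum_power2[of "Suc S"] by (simp add: atLeast0LessThan lessThan_Suc_atMost)
  finally show ?thesis by simp
qed

text \<open>One string \<open>P\<close> serves all shifts, and the canonical set for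
  \<open>s\<close> is recovered from \<open>k\<close> memory states alone. So there are at most as
  many canonical sets as tuples, and these sets must cover all \<open>n + 1\<close> shifts.\<close>

lemma shifts_le_tuples:
  assumes c: "c > 1" and n: "n > 1"
    and queries: "sf_makes_queries c n q Q" and canonical: "sf_canonical c n Q M"
    and finds: "sf_finds_shift c n t M"
    and A: "solves_approx_count c n (A :: 'a stream_alg)" "stream_pseudo_deterministic c n A"
    and space: "uses_space c n A S"
    and k: "(4 / 5) ^ k * real q < 2 / 5"
  shows "n < 2 ^ (Suc S * k) * t"
proof -
  obtain P where lenP: "length P = nat \<lfloor>(c - 1) * real n\<rfloor>"
    and P: "\<And>s x. s \<le> n \<Longrightarrow> real x \<le> c * real n \<Longrightarrow>
      pmf (stream_output A (replicate (s + x) undefined)) (sf_oracle n P s x) \<ge> 9 / 10"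
    using ex_string_encoding[OF c n A] by blast
  define b where "b w x \<longleftrightarrow> pmf (output_from A w (replicate x undefined)) True > 1 / 2" for w x
  define X where "X = {x. real x \<le> c * real n}"
  define B where "B = {w :: bool list. length w \<le> S}"
  define Ws where "Ws = {ws. set ws \<subseteq> B \<and> length ws = k}"
  \<comment> \<open>The decoder does not refer to \<open>s\<close>. At most one output can have
    probability above 1/2, so the description is unique whenever it is satisfied.\<close>
  define decode where
    "decode ws = (THE R. pmf (map_pmf (tree_result (majority b ws)) (Q P)) R > 1 / 2)" for ws
  have finX: "finite X"
    by (rule finite_subset[of _ "{..nat \<lfloor>c * real n\<rfloor>}"]) (simp_all add: X_def subset_iff le_nat_floor)
  have finB: "finite B"
    using finite_lists_length_le[of "UNIV :: bool set" S] by (simp add: B_def)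
  have finWs: "finite Ws"
    unfolding Ws_def by (rule finite_lists_length_eq[OF finB])
  have inst: "sf_instance c n P s" if "s \<le> n" for s
    using that lenP by (simp add: sf_instance_def)
  have tuple: "\<exists>ws\<in>Ws. decode ws = M P s" if s: "s \<le> n" for s
  proof -
    define D where "D = memory_after A (replicate s undefined)"
    have "real s \<le> (c + 1) * real n"
      using s c mult_right_mono[of 1 "c + 1" "real n"] by simp
    then have "input_stream c n (replicate s (undefined :: 'a))"
      by (simp add: input_stream_def)
    then have DB: "set_pmf D \<subseteq> B"
      using space by (auto simp: uses_space_def B_def D_def)
    have weak: "measure_pmf.prob D {w. b w x \<noteq> sf_oracle n P s x} \<le> 1 / 5" if "x \<in> X" for x
      unfolding b_def
    proof (rule prob_rounded_wrong_le)
      show "pmf (D \<bind> (\<lambda>w. output_from A w (replicate x undefined))) (sf_oracle n P s x) \<ge> 9 / 10"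
        using P[OF s, of x] that
        by (simp add: D_def X_def stream_output_append[symmetric] replicate_add)
    qed
    have "\<exists>ws. length ws = k \<and> set ws \<subseteq> set_pmf D \<and>
      pmf (map_pmf (tree_result (majority b ws)) (Q P)) (M P s) > 1 / 2"
    proof (rule ex_voters_majority_correct[where X = X and f = "sf_oracle n P s" and q = q])
      show "finite (set_pmf D)" using DB finB by (rule finite_subset)
      show "length (queries_made (sf_oracle n P s) T) \<le> q \<and>
        set (queries_made (sf_oracle n P s) T) \<subseteq> X" if "T \<in> set_pmf (Q P)" for T
        using queries inst[OF s] that by (auto simp: sf_makes_queries_def X_def)
      show "pmf (map_pmf (tree_result (sf_oracle n P s)) (Q P)) (M P s) \<ge> 9 / 10"
        using canonical inst[OF s] by (auto simp: sf_canonical_def sf_output_def)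
    qed (use finX weak k in auto)
    then obtain ws where ws: "length ws = k" "set ws \<subseteq> set_pmf D"
      and maj: "pmf (map_pmf (tree_result (majority b ws)) (Q P)) (M P s) > 1 / 2"
      by blast
    have "decode ws = M P s"
      unfolding decode_def using maj by (intro the_equality pmf_eq_if_gt_half)
    then show ?thesis using ws DB by (auto simp: Ws_def)
  qed
  have M: "M P s \<subseteq> {0..n} \<and> card (M P s) = t \<and> s \<in> M P s" if "s \<le> n" for s
    using finds inst[OF that] by (auto simp: sf_finds_shift_def)
  have "\<Union> (M P ` {0..n}) = {0..n}"
  proof
    show "\<Union> (M P ` {0..n}) \<subseteq> {0..n}" using M by (intro UN_least) simp
    show "{0..n} \<subseteq> \<Union> (M P ` {0..n})" using M by force
  qed
  then have "card {0..n} = card (\<Union> (M P ` {0..n}))"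
    by simp
  \<comment> \<open>The sum runs over distinct canonical sets, not over shifts, so a set shared by
    several shifts counts once.\<close>
  also have "\<dots> \<le> (\<Sum>R\<in>M P ` {0..n}. card R)"
    using card_UN_le[of "M P ` {0..n}" id] by simp
  also have "\<dots> = (\<Sum>R\<in>M P ` {0..n}. t)"
    using M by (intro sum.cong) auto
  also have "\<dots> = card (M P ` {0..n}) * t"
    by simp
  also have "card (M P ` {0..n}) \<le> card Ws"
  proof (rule surj_card_le[OF finWs])
    show "M P ` {0..n} \<subseteq> decode ` Ws" using tuple by force
  qed
  also have "card Ws = card B ^ k"
    unfolding Ws_def by (rule card_lists_length_eq[OF finB])
  also have "\<dots> \<le> (2 ^ Suc S) ^ k"
    unfolding B_def by (intro power_mono card_bool_lists_le) auto
  also have "(2 ^ Suc S) ^ k = (2::nat) ^ (Suc S * k)"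
    by (rule power_mult[symmetric])
  finally show ?thesis by simp
qed

section \<open>Choice of the number of voters and the final bound\<close>

text \<open>Since \<open>(4 / 5) ^ 4 < 1 / 2\<close>, every four voters halve the potential. After
  about \<open>log 2 q + 2\<close> halvings it is at most 1/4, below the required 2/5.\<close>

lemma ex_number_of_voters:
  assumes "q \<ge> 2"
  shows "\<exists>k. (4 / 5) ^ k * real q < 2 / 5 \<and> real k \<le> 16 * log 2 (real q)"
proof -
  define m where "m = nat \<lceil>log 2 (real q)\<rceil> + 2"
  have lq: "log 2 (real q) \<ge> 1"
    using assms by (simp add: le_log_iff)
  have m: "real m \<le> log 2 (real q) + 3" "log 2 (real q) + 2 \<le> real m"
    using lq by (simp_all add: m_def) linarith+
  have "log 2 (4 * real q) = log 2 (real q) + log 2 (2 ^ 2)"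
    using assms by (simp add: log_mult)
  also have "log 2 (2 ^ 2 :: real) = 2"
    by (subst log_nat_power) auto
  finally have "log 2 (4 * real q) \<le> real m" using m(2) by simp
  then have "4 * real q \<le> 2 powr real m"
    using assms by (simp add: log_le_iff)
  then have "4 * real q \<le> 2 ^ m"
    by (simp add: powr_realpow)
  then have q: "(1 / 2) ^ m * real q \<le> 1 / 4"
    by (simp add: power_divide field_simps)
  have "(4 / 5 :: real) ^ (4 * m) = ((4 / 5) ^ 4) ^ m"
    by (rule power_mult)
  also have "\<dots> \<le> (1 / 2) ^ m"
    by (intro power_mono) (auto simp: power_divide)
  finally have "(4 / 5) ^ (4 * m) * real q \<le> (1 / 2) ^ m * real q"
    by (intro mult_right_mono) auto
  then have "(4 / 5) ^ (4 * m) * real q < 2 / 5" using q by linarith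
  \<comment> \<open>From \<open>log 2 q \<ge> 1\<close> follows
    \<open>m \<le> log 2 q + 3 \<le> 4 * log 2 q\<close>.\<close>
  moreover have "real (4 * m) \<le> 16 * log 2 (real q)" using m(1) lq by simp
  ultimately show ?thesis by blast
qed

theorem theorem1p6:
  "\<exists>C::real. C > 0 \<and>
     (\<forall>(c::real) (n::nat) (q::nat) (t::nat) (Q::sf_algorithm) (M :: bool list \<Rightarrow> nat \<Rightarrow> nat set).
        c > 1 \<longrightarrow> n > 1 \<longrightarrow>
        sf_makes_queries c n q Q \<longrightarrow> sf_canonical c n Q M \<longrightarrow> sf_finds_shift c n t M \<longrightarrow>
        (\<forall>(A :: 'a stream_alg) (S::nat).
           solves_approx_count c n A \<longrightarrow> stream_pseudo_deterministic c n A \<longrightarrow>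
           uses_space c n A S \<longrightarrow>
           real S \<ge> C * (log 2 (real n / real t) / log 2 (real q))))"
proof (intro exI[of _ "1 / 32"] conjI allI impI)
  fix c :: real and n q t S :: nat and Q M and A :: "'a stream_alg"
  assume c: "c > 1" and n: "n > 1"
    and Q: "sf_makes_queries c n q Q" "sf_canonical c n Q M" "sf_finds_shift c n t M"
    and A: "solves_approx_count c n A" "stream_pseudo_deterministic c n A" "uses_space c n A S"
  show "real S \<ge> 1 / 32 * (log 2 (real n / real t) / log 2 (real q))"
  proof (cases "q \<ge> 2")
    case False
    \<comment> \<open>Here \<open>log 2 q = 0\<close>, also for \<open>q = 0\<close>, and the quotient is \<open>0\<close>.\<close>
    then have "q = 0 \<or> q = 1" by auto
    then show ?thesis by (auto simp: log_def)
  next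
    case True
    then obtain k where k: "(4 / 5) ^ k * real q < 2 / 5" "real k \<le> 16 * log 2 (real q)"
      using ex_number_of_voters by blast
    have S: "S \<ge> 1" by (rule space_pos[OF c n A(1,3)])
    have lt: "n < 2 ^ (Suc S * k) * t"
      by (rule shifts_le_tuples[OF c n Q A k(1)])
    then have t: "t > 0" by (cases t) auto
    have "real n \<le> real (2 ^ (Suc S * k) * t)"
      using lt by (intro of_nat_mono) simp
    then have "real n / real t \<le> 2 ^ (Suc S * k)"
      using t by (simp add: pos_divide_le_eq del: mult_Suc)
    also have "\<dots> = 2 powr real (Suc S * k)"
      by (rule powr_realpow[symmetric]) simp
    finally have "log 2 (real n / real t) \<le> real (Suc S * k)"
      using n t by (subst log_le_iff) auto
    also have "\<dots> = real (Suc S) * real k"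
      by (rule of_nat_mult)
    \<comment> \<open>\<open>S \<ge> 1\<close> gives \<open>Suc S \<le> 2 * S\<close>; the factors 2
      and 16 make up the constant 1/32.\<close>
    also have "\<dots> \<le> (2 * real S) * (16 * log 2 (real q))"
      using S k(2) by (intro mult_mono) auto
    finally have "log 2 (real n / real t) \<le> real S * (32 * log 2 (real q))" by simp
    moreover have "log 2 (real q) > 0" using True by simp
    ultimately show ?thesis by (simp add: field_simps)
  qed
qed simp

end
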